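(* Let $E$ be a Lie-Yamaguti algebra, $\mathfrak g$ be a Lie-Yamaguti subalgebra of $E$, and $\mathfrak h$ be any strong $\mathfrak g$-complement in $E$ with the associated canonical matched pair $(\mathfrak g,\mathfrak h,(\rho,\mu),(\psi,\nu))$. (i) For any deformation map $r:\mathfrak h\to\mathfrak g$ in the canonical matched pair, the graph $Graph(r)=\{(r(\alpha),\alpha)\mid\alpha\in\mathfrak h\}$ is also a $\mathfrak g$-complement in $E$. (ii) Conversely, let $\overline{\mathfrak h}$ be any other $\mathfrak g$-complement in $E$. Then there exists a deformation map $r:\mathfrak h\to\mathfrak g$ in the canonical matched pair such that $\overline{\mathfrak h}=Graph(r)$ as Lie-Yamaguti algebras.
   Context: All vector spaces and (multi)linear maps are over a field $\mathbf k$ of characteristic $0$. **Lie-Yamaguti algebra.** A vector space $\mathfrak g$ with linear maps $[\,,]:\wedge^2\mathfrak g\to\mathfrak g$ and $\langle\,,,\rangle:\wedge^2\mathfrak g\otimes\mathfrak g\to\mathfrak g$ such that for all $x,y,z,w,t\in\mathfrak g$: $[[x,y],z]+[[y,z],x]+[[z,x],y]+\langle x,y,z\rangle+\langle y,z,x\rangle+\langle z,x,y\rangle=0$; $\langle[x,y],z,w\rangle+\langle[y,z],x,w\rangle+\langle[z,x],y,w\rangle=0$; $\langle x,y,[z,w]\rangle=[\langle x,y,z\rangle,w]+[z,\langle x,y,w\rangle]$; $\langle x,y,\langle z,w,t\rangle\rangle=\langle\langle x,y,z\rangle,w,t\rangle+\langle z,\langle x,y,w\rangle,t\rangle+\langle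 z,w,\langle x,y,t\rangle\rangle$. Homomorphisms are linear maps preserving both operations; a subalgebra is a subspace closed under both operations. **Complements.** Let $(E,[\,,]_E,\langle\,,,\rangle_E)$ be a Lie-Yamaguti algebra and $\mathfrak g\subset E$ a Lie-Yamaguti subalgebra. A $\mathfrak g$-complement in $E$ is a Lie-Yamaguti subalgebra $\mathfrak h\subset E$ with $E=\mathfrak g+\mathfrak h$ and $\mathfrak g\cap\mathfrak h=\{0\}$. It is a strong $\mathfrak g$-complement if additionally $\langle\mathfrak g,\mathfrak h,\mathfrak h\rangle_E\subset\mathfrak g$ and $\langle\mathfrak h,\mathfrak g,\mathfrak g\rangle_E\subset\mathfrak h$. The restricted structures on $\mathfrak g$, $\mathfrak h$ are written $([\,,],\langle\,,,\rangle)$ and $([\,,]',\langle\,,,\rangle')$. **Representation.** A representation $(V;\rho,\mu)$ of $\mathfrak g$ is a vector space $V$ with linear maps $\rho:\mathfrak g\to\mathrm{End}(V)$, $x\mapsto\rho_x$, and $\mu:\mathfrak g\otimes\mathfrak g\to\mathrm{End}(V)$ such that, with $D_{\rho,\mu}(x,y):=\rho_x\rho_y-\rho_y\rho_x-\rho_{[x,y]}-\mu(x,y)+\mu(y,x)$, for all $x,y,z,w\in\mathfrak g$: $\mu([x,y],z)=\mu(x,z)\rho_y-\mu(y,z)\rho_x$; $\mu(x,[y,z])=\rho_y\mu(x,z)-\rho_z\mu(x,y)$; $\rho_{\langle x,y,z\rangle}=D_{\rho,\mu}(x,y)\rho_z-\rho_zD_{\rho,\mu}(x,y)$; $\mu(z,w)\mu(x,y)-\mu(y,w)\mu(x,z)-\mu(x,\langle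 y,z,w\rangle)+D_{\rho,\mu}(y,z)\mu(x,w)=0$; $\mu(\langle x,y,z\rangle,w)+\mu(z,\langle x,y,w\rangle)=D_{\rho,\mu}(x,y)\mu(z,w)-\mu(z,w)D_{\rho,\mu}(x,y)$. **Matched pair.** A matched pair of Lie-Yamaguti algebras $(\mathfrak g,\mathfrak h,(\rho,\mu),(\psi,\nu))$ consists of Lie-Yamaguti algebras $(\mathfrak g,[\,,],\langle\,,,\rangle)$, $(\mathfrak h,[\,,]',\langle\,,,\rangle')$ and linear maps $\rho:\mathfrak g\to\mathrm{End}(\mathfrak h)$, $\mu:\mathfrak g\otimes\mathfrak g\to\mathrm{End}(\mathfrak h)$, $\psi:\mathfrak h\to\mathrm{End}(\mathfrak g)$, $\nu:\mathfrak h\otimes\mathfrak h\to\mathrm{End}(\mathfrak g)$ such that $(\mathfrak h;\rho,\mu)$ is a representation of $\mathfrak g$, $(\mathfrak g;\psi,\nu)$ is a representation of $\mathfrak h$, and for all $x,y,z\in\mathfrak g$, $\alpha,\beta,\gamma\in\mathfrak h$: (1) $\rho_x([\alpha,\beta]')=[\rho_x\alpha,\beta]'+[\alpha,\rho_x\beta]'+\rho_{\psi_\beta x}\alpha-\rho_{\psi_\alpha x}\beta$; (2) $\rho_x(\langle\alpha,\beta,\gamma\rangle')=\langle\alpha,\beta,\rho_x\gamma\rangle'-\rho_{D_{\psi,\nu}(\alpha,\beta)x}\gamma$; (3) $\langle\rho_x\alpha,\beta,\gamma\rangle'+\langle\alpha,\rho_x\beta,\gamma\rangle'=0$; (4) $\rho_{\nu(\alpha,\beta)x}\gamma=\rho_{\nu(\alpha,\gamma)x}\beta$;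 (5) $\mu(x,y)([\alpha,\beta]')=\mu(\psi_\beta x,y)\alpha-\mu(\psi_\alpha x,y)\beta$; (6) $\mu(x,y)\langle\alpha,\beta,\gamma\rangle'=\langle\alpha,\beta,\mu(x,y)\gamma\rangle'-\mu(D_{\psi,\nu}(\alpha,\beta)x,y)\gamma-\mu(x,D_{\psi,\nu}(\alpha,\beta)y)\gamma$; (7) $\mu(x,\psi_\alpha y)\beta=[\alpha,\mu(x,y)\beta]'$; (8) $\mu(\nu(\alpha,\beta)x,y)\gamma-\mu(\nu(\alpha,\gamma)x,y)\beta=\mu(x,D_{\psi,\nu}(\beta,\gamma)y)\alpha-\langle\beta,\gamma,\mu(x,y)\alpha\rangle'$; (9) $\mu(x,\nu(\alpha,\beta)y)\gamma=\langle\mu(x,y)\gamma,\alpha,\beta\rangle'-D_{\rho,\mu}(y,\nu(\gamma,\alpha)x)\beta+\mu(y,\nu(\gamma,\beta)x)\alpha$; (10) $\psi_\alpha([x,y])=[\psi_\alpha x,y]+[x,\psi_\alpha y]+\psi_{\rho_y\alpha}x-\psi_{\rho_x\alpha}y$; (11) $\psi_\alpha(\langle x,y,z\rangle)=\langle x,y,\psi_\alpha z\rangle-\psi_{D_{\rho,\mu}(x,y)\alpha}z$; (12) $\langle\psi_\alpha x,y,z\rangle+\langle x,\psi_\alpha y,z\rangle=0$; (13) $\psi_{\mu(x,y)\alpha}z=\psi_{\mu(x,z)\alpha}y$; (14) $\nu(\alpha,\beta)([x,y])=\nu(\rho_y\alpha,\beta)x-\nu(\rho_x\alpha,\beta)y$;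 (15) $\nu(\alpha,\beta)\langle x,y,z\rangle=\langle x,y,\nu(\alpha,\beta)z\rangle-\nu(D_{\rho,\mu}(x,y)\alpha,\beta)z-\nu(\alpha,D_{\rho,\mu}(x,y)\beta)z$; (16) $\nu(\alpha,\rho_x\beta)y=[x,\nu(\alpha,\beta)y]$; (17) $\nu(\mu(x,y)\alpha,\beta)z-\nu(\mu(x,z)\alpha,\beta)y=\nu(\alpha,D_{\rho,\mu}(y,z)\beta)x-\langle y,z,\nu(\alpha,\beta)x\rangle$; (18) $\nu(\alpha,\mu(x,y)\beta)z=\langle\nu(\alpha,\beta)z,x,y\rangle-D_{\psi,\nu}(\beta,\mu(z,x)\alpha)y+\nu(\beta,\mu(z,y)\alpha)x$. **Bicrossed product.** $\mathfrak g\bowtie\mathfrak h$ is the Lie-Yamaguti algebra on $\mathfrak g\oplus\mathfrak h$ with operations $[(x,\alpha),(y,\beta)]_{\bowtie}=([x,y]+\psi_\alpha y-\psi_\beta x,\ [\alpha,\beta]'+\rho_x\beta-\rho_y\alpha)$, $\langle(x,\alpha),(y,\beta),(z,\gamma)\rangle_{\bowtie}=(\langle x,y,z\rangle+D_{\psi,\nu}(\alpha,\beta)z+\nu(\beta,\gamma)x-\nu(\alpha,\gamma)y,\ \langle\alpha,\beta,\gamma\rangle'+D_{\rho,\mu}(x,y)\gamma+\mu(y,z)\alpha-\mu(x,z)\beta)$. (It is known that this is a Lie-Yamaguti algebra.) **Canonical matched pair.** For a strong $\mathfrak g$-complement $\mathfrak h$ in $E$, write elements of $E$ uniquely as pairs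 $(x,\alpha)=x+\alpha$ with $x\in\mathfrak g$, $\alpha\in\mathfrak h$. The canonical matched pair $(\mathfrak g,\mathfrak h,(\rho,\mu),(\psi,\nu))$ is the matched pair determined by $[(x,0),(0,\alpha)]_E=(-\psi_\alpha x,\rho_x\alpha)$, $\langle(0,\alpha),(x,0),(y,0)\rangle_E=(0,\mu(x,y)\alpha)$, $\langle(x,0),(0,\alpha),(0,\beta)\rangle_E=(\nu(\alpha,\beta)x,0)$, under which $E$ is identified with $\mathfrak g\bowtie\mathfrak h$ as a Lie-Yamaguti algebra via $x+\alpha\leftrightarrow(x,\alpha)$. Graphs are regarded as subsets of $E$ by this identification. **Deformation map.** A linear map $r:\mathfrak h\to\mathfrak g$ is a deformation map in the matched pair if for all $\alpha,\beta,\gamma\in\mathfrak h$: $[r(\alpha),r(\beta)]+\psi_\alpha r(\beta)-\psi_\beta r(\alpha)=r([\alpha,\beta]'+\rho_{r(\alpha)}\beta-\rho_{r(\beta)}\alpha)$, and $\langle r(\alpha),r(\beta),r(\gamma)\rangle+D_{\psi,\nu}(\alpha,\beta)r(\gamma)+\nu(\beta,\gamma)r(\alpha)-\nu(\alpha,\gamma)r(\beta)=r(\langle\alpha,\beta,\gamma\rangle'+D_{\rho,\mu}(r(\alpha),r(\beta))\gamma+\mu(r(\beta),r(\gamma))\alpha-\mu(r(\alpha),r(\gamma))\beta)$.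
   Formalization: The strong complement is assumed actually to have a canonical matched pair (the maps read off from E satisfy all matched-pair identities); the strong-complement axioms alone do not guarantee this, and the statement is undefined otherwise. *)

theory Defs
  imports Complex_Main
begin

section \<open>Vector spaces and linear maps on carriers\<close>

text \<open>A vector space is a subspace \<open>V\<close> of an ambient type carrying a scalar multiplication \<open>s\<close>;
  maps are only constrained on carriers.\<close>

definition vector_space_on :: "('k::field \<Rightarrow> 'v::ab_group_add \<Rightarrow> 'v) \<Rightarrow> 'v set \<Rightarrow> bool" where
  "vector_space_on s V \<longleftrightarrow> vector_space s \<and> module.subspace s V"

definition linear_map_on ::
  "('k::field \<Rightarrow> 'v::ab_group_add \<Rightarrow> 'v) \<Rightarrow> 'v set \<Rightarrow>
   ('k \<Rightarrow> 'w::ab_group_add \<Rightarrow> 'w) \<Rightarrow> 'w set \<Rightarrow> ('v \<Rightarrow> 'w) \<Rightarrow> bool" where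
  "linear_map_on s V t W f \<longleftrightarrow>
     (\<forall>x\<in>V. f x \<in> W) \<and>
     (\<forall>x\<in>V. \<forall>y\<in>V. f (x + y) = f x + f y) \<and>
     (\<forall>c. \<forall>x\<in>V. f (s c x) = t c (f x))"

text \<open>Linear maps \<open>V \<rightarrow> End(W)\<close> and \<open>V \<otimes> V \<rightarrow> End(W)\<close>, the latter given as bilinear maps.\<close>

definition linear_to_End ::
  "('k::field \<Rightarrow> 'v::ab_group_add \<Rightarrow> 'v) \<Rightarrow> 'v set \<Rightarrow>
   ('k \<Rightarrow> 'w::ab_group_add \<Rightarrow> 'w) \<Rightarrow> 'w set \<Rightarrow> ('v \<Rightarrow> 'w \<Rightarrow> 'w) \<Rightarrow> bool" where
  "linear_to_End s V t W \<rho> \<longleftrightarrow>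
     (\<forall>x\<in>V. linear_map_on t W t W (\<rho> x)) \<and>
     (\<forall>w\<in>W. linear_map_on s V t W (\<lambda>x. \<rho> x w))"

definition bilinear_to_End ::
  "('k::field \<Rightarrow> 'v::ab_group_add \<Rightarrow> 'v) \<Rightarrow> 'v set \<Rightarrow>
   ('k \<Rightarrow> 'w::ab_group_add \<Rightarrow> 'w) \<Rightarrow> 'w set \<Rightarrow> ('v \<Rightarrow> 'v \<Rightarrow> 'w \<Rightarrow> 'w) \<Rightarrow> bool" where
  "bilinear_to_End s V t W \<mu> \<longleftrightarrow>
     (\<forall>x\<in>V. linear_to_End s V t W (\<mu> x)) \<and>
     (\<forall>y\<in>V. linear_to_End s V t W (\<lambda>x. \<mu> x y))"

section \<open>Lie-Yamaguti algebras\<close>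

record ('k, 'v) ly_structure =
  carrier :: "'v set"
  scl :: "'k \<Rightarrow> 'v \<Rightarrow> 'v"
  br :: "'v \<Rightarrow> 'v \<Rightarrow> 'v"
  tr :: "'v \<Rightarrow> 'v \<Rightarrow> 'v \<Rightarrow> 'v"

definition lie_yamaguti :: "('k::field_char_0, 'v::ab_group_add) ly_structure \<Rightarrow> bool" where
  "lie_yamaguti L \<longleftrightarrow>
     vector_space_on (scl L) (carrier L) \<and>
     (\<forall>x\<in>carrier L. linear_map_on (scl L) (carrier L) (scl L) (carrier L) (br L x)) \<and>
     (\<forall>y\<in>carrier L. linear_map_on (scl L) (carrier L) (scl L) (carrier L) (\<lambda>x. br L x y)) \<and>
     (\<forall>x\<in>carrier L. br L x x = 0) \<and>
     (\<forall>x\<in>carrier L. \<forall>y\<in>carrier L.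
        linear_map_on (scl L) (carrier L) (scl L) (carrier L) (\<lambda>z. tr L x y z)) \<and>
     (\<forall>x\<in>carrier L. \<forall>z\<in>carrier L.
        linear_map_on (scl L) (carrier L) (scl L) (carrier L) (\<lambda>y. tr L x y z)) \<and>
     (\<forall>y\<in>carrier L. \<forall>z\<in>carrier L.
        linear_map_on (scl L) (carrier L) (scl L) (carrier L) (\<lambda>x. tr L x y z)) \<and>
     (\<forall>x\<in>carrier L. \<forall>z\<in>carrier L. tr L x x z = 0) \<and>
     (\<forall>x\<in>carrier L. \<forall>y\<in>carrier L. \<forall>z\<in>carrier L.
        br L (br L x y) z + br L (br L y z) x + br L (br L z x) y
        + tr L x y z + tr L y z x + tr L z x y = 0) \<and>
     (\<forall>x\<in>carrier L. \<forall>y\<in>carrier L. \<forall>z\<in>carrier L. \<forall>w\<in>carrier L.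
        tr L (br L x y) z w + tr L (br L y z) x w + tr L (br L z x) y w = 0) \<and>
     (\<forall>x\<in>carrier L. \<forall>y\<in>carrier L. \<forall>z\<in>carrier L. \<forall>w\<in>carrier L.
        tr L x y (br L z w) = br L (tr L x y z) w + br L z (tr L x y w)) \<and>
     (\<forall>x\<in>carrier L. \<forall>y\<in>carrier L. \<forall>z\<in>carrier L. \<forall>w\<in>carrier L. \<forall>t\<in>carrier L.
        tr L x y (tr L z w t) =
          tr L (tr L x y z) w t + tr L z (tr L x y w) t + tr L z w (tr L x y t))"

definition ly_subalgebra ::
  "'v set \<Rightarrow> ('k::field_char_0, 'v::ab_group_add) ly_structure \<Rightarrow> bool" where
  "ly_subalgebra S L \<longleftrightarrow>
     S \<subseteq> carrier L \<and> module.subspace (scl L) S \<and>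
     (\<forall>x\<in>S. \<forall>y\<in>S. br L x y \<in> S) \<and>
     (\<forall>x\<in>S. \<forall>y\<in>S. \<forall>z\<in>S. tr L x y z \<in> S)"

definition restr :: "('k, 'v) ly_structure \<Rightarrow> 'v set \<Rightarrow> ('k, 'v) ly_structure" where
  "restr L S = L\<lparr>carrier := S\<rparr>"

section \<open>Complements\<close>

definition ly_complement ::
  "('k::field_char_0, 'v::ab_group_add) ly_structure \<Rightarrow> 'v set \<Rightarrow> 'v set \<Rightarrow> bool" where
  "ly_complement E G H \<longleftrightarrow>
     ly_subalgebra H E \<and>
     carrier E = {x + \<alpha> | x \<alpha>. x \<in> G \<and> \<alpha> \<in> H} \<and>
     G \<inter> H = {0}"

definition strong_ly_complement ::
  "('k::field_char_0, 'v::ab_group_add) ly_structure \<Rightarrow> 'v set \<Rightarrow> 'v set \<Rightarrow> bool" where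
  "strong_ly_complement E G H \<longleftrightarrow>
     ly_complement E G H \<and>
     (\<forall>x\<in>G. \<forall>\<alpha>\<in>H. \<forall>\<beta>\<in>H. tr E x \<alpha> \<beta> \<in> G) \<and>
     (\<forall>\<alpha>\<in>H. \<forall>x\<in>G. \<forall>y\<in>G. tr E \<alpha> x y \<in> H)"

section \<open>Representations and matched pairs\<close>

definition D_op ::
  "('k, 'v) ly_structure \<Rightarrow> ('v \<Rightarrow> 'w \<Rightarrow> 'w) \<Rightarrow> ('v \<Rightarrow> 'v \<Rightarrow> 'w \<Rightarrow> 'w) \<Rightarrow>
   'v \<Rightarrow> 'v \<Rightarrow> 'w \<Rightarrow> 'w::ab_group_add" where
  "D_op L \<rho> \<mu> x y w =
     \<rho> x (\<rho> y w) - \<rho> y (\<rho> x w) - \<rho> (br L x y) w - \<mu> x y w + \<mu> y x w"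

definition ly_representation ::
  "('k::field_char_0, 'v::ab_group_add) ly_structure \<Rightarrow>
   ('k \<Rightarrow> 'w::ab_group_add \<Rightarrow> 'w) \<Rightarrow> 'w set \<Rightarrow>
   ('v \<Rightarrow> 'w \<Rightarrow> 'w) \<Rightarrow> ('v \<Rightarrow> 'v \<Rightarrow> 'w \<Rightarrow> 'w) \<Rightarrow> bool" where
  "ly_representation L s V \<rho> \<mu> \<longleftrightarrow>
     vector_space_on s V \<and>
     linear_to_End (scl L) (carrier L) s V \<rho> \<and>
     bilinear_to_End (scl L) (carrier L) s V \<mu> \<and>
     (\<forall>x\<in>carrier L. \<forall>y\<in>carrier L. \<forall>z\<in>carrier L. \<forall>v\<in>V.
        \<mu> (br L x y) z v = \<mu> x z (\<rho> y v) - \<mu> y z (\<rho> x v)) \<and>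
     (\<forall>x\<in>carrier L. \<forall>y\<in>carrier L. \<forall>z\<in>carrier L. \<forall>v\<in>V.
        \<mu> x (br L y z) v = \<rho> y (\<mu> x z v) - \<rho> z (\<mu> x y v)) \<and>
     (\<forall>x\<in>carrier L. \<forall>y\<in>carrier L. \<forall>z\<in>carrier L. \<forall>v\<in>V.
        \<rho> (tr L x y z) v = D_op L \<rho> \<mu> x y (\<rho> z v) - \<rho> z (D_op L \<rho> \<mu> x y v)) \<and>
     (\<forall>x\<in>carrier L. \<forall>y\<in>carrier L. \<forall>z\<in>carrier L. \<forall>w\<in>carrier L. \<forall>v\<in>V.
        \<mu> z w (\<mu> x y v) - \<mu> y w (\<mu> x z v) - \<mu> x (tr L y z w) v
        + D_op L \<rho> \<mu> y z (\<mu> x w v) = 0) \<and>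
     (\<forall>x\<in>carrier L. \<forall>y\<in>carrier L. \<forall>z\<in>carrier L. \<forall>w\<in>carrier L. \<forall>v\<in>V.
        \<mu> (tr L x y z) w v + \<mu> z (tr L x y w) v =
          D_op L \<rho> \<mu> x y (\<mu> z w v) - \<mu> z w (D_op L \<rho> \<mu> x y v))"

definition matched_pair ::
  "('k::field_char_0, 'g::ab_group_add) ly_structure \<Rightarrow> ('k, 'h::ab_group_add) ly_structure \<Rightarrow>
   ('g \<Rightarrow> 'h \<Rightarrow> 'h) \<Rightarrow> ('g \<Rightarrow> 'g \<Rightarrow> 'h \<Rightarrow> 'h) \<Rightarrow>
   ('h \<Rightarrow> 'g \<Rightarrow> 'g) \<Rightarrow> ('h \<Rightarrow> 'h \<Rightarrow> 'g \<Rightarrow> 'g) \<Rightarrow> bool" where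
  "matched_pair A B \<rho> \<mu> \<psi> \<nu> \<longleftrightarrow>
     lie_yamaguti A \<and> lie_yamaguti B \<and>
     ly_representation A (scl B) (carrier B) \<rho> \<mu> \<and>
     ly_representation B (scl A) (carrier A) \<psi> \<nu> \<and>
     (\<forall>x\<in>carrier A. \<forall>y\<in>carrier A. \<forall>z\<in>carrier A.
      \<forall>\<alpha>\<in>carrier B. \<forall>\<beta>\<in>carrier B. \<forall>\<gamma>\<in>carrier B.
      \<rho> x (br B \<alpha> \<beta>) = br B (\<rho> x \<alpha>) \<beta> + br B \<alpha> (\<rho> x \<beta>) + \<rho> (\<psi> \<beta> x) \<alpha> - \<rho> (\<psi> \<alpha> x) \<beta> \<and>
      \<rho> x (tr B \<alpha> \<beta> \<gamma>) = tr B \<alpha> \<beta> (\<rho> x \<gamma>) - \<rho> (D_op B \<psi> \<nu> \<alpha> \<beta> x) \<gamma> \<and>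
      tr B (\<rho> x \<alpha>) \<beta> \<gamma> + tr B \<alpha> (\<rho> x \<beta>) \<gamma> = 0 \<and>
      \<rho> (\<nu> \<alpha> \<beta> x) \<gamma> = \<rho> (\<nu> \<alpha> \<gamma> x) \<beta> \<and>
      \<mu> x y (br B \<alpha> \<beta>) = \<mu> (\<psi> \<beta> x) y \<alpha> - \<mu> (\<psi> \<alpha> x) y \<beta> \<and>
      \<mu> x y (tr B \<alpha> \<beta> \<gamma>) =
        tr B \<alpha> \<beta> (\<mu> x y \<gamma>) - \<mu> (D_op B \<psi> \<nu> \<alpha> \<beta> x) y \<gamma> - \<mu> x (D_op B \<psi> \<nu> \<alpha> \<beta> y) \<gamma> \<and>
      \<mu> x (\<psi> \<alpha> y) \<beta> = br B \<alpha> (\<mu> x y \<beta>) \<and>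
      \<mu> (\<nu> \<alpha> \<beta> x) y \<gamma> - \<mu> (\<nu> \<alpha> \<gamma> x) y \<beta> =
        \<mu> x (D_op B \<psi> \<nu> \<beta> \<gamma> y) \<alpha> - tr B \<beta> \<gamma> (\<mu> x y \<alpha>) \<and>
      \<mu> x (\<nu> \<alpha> \<beta> y) \<gamma> =
        tr B (\<mu> x y \<gamma>) \<alpha> \<beta> - D_op A \<rho> \<mu> y (\<nu> \<gamma> \<alpha> x) \<beta> + \<mu> y (\<nu> \<gamma> \<beta> x) \<alpha> \<and>
      \<psi> \<alpha> (br A x y) = br A (\<psi> \<alpha> x) y + br A x (\<psi> \<alpha> y) + \<psi> (\<rho> y \<alpha>) x - \<psi> (\<rho> x \<alpha>) y \<and>
      \<psi> \<alpha> (tr A x y z) = tr A x y (\<psi> \<alpha> z) - \<psi> (D_op A \<rho> \<mu> x y \<alpha>) z \<and>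
      tr A (\<psi> \<alpha> x) y z + tr A x (\<psi> \<alpha> y) z = 0 \<and>
      \<psi> (\<mu> x y \<alpha>) z = \<psi> (\<mu> x z \<alpha>) y \<and>
      \<nu> \<alpha> \<beta> (br A x y) = \<nu> (\<rho> y \<alpha>) \<beta> x - \<nu> (\<rho> x \<alpha>) \<beta> y \<and>
      \<nu> \<alpha> \<beta> (tr A x y z) =
        tr A x y (\<nu> \<alpha> \<beta> z) - \<nu> (D_op A \<rho> \<mu> x y \<alpha>) \<beta> z - \<nu> \<alpha> (D_op A \<rho> \<mu> x y \<beta>) z \<and>
      \<nu> \<alpha> (\<rho> x \<beta>) y = br A x (\<nu> \<alpha> \<beta> y) \<and>
      \<nu> (\<mu> x y \<alpha>) \<beta> z - \<nu> (\<mu> x z \<alpha>) \<beta> y =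
        \<nu> \<alpha> (D_op A \<rho> \<mu> y z \<beta>) x - tr A y z (\<nu> \<alpha> \<beta> x) \<and>
      \<nu> \<alpha> (\<mu> x y \<beta>) z =
        tr A (\<nu> \<alpha> \<beta> z) x y - D_op B \<psi> \<nu> \<beta> (\<mu> z x \<alpha>) y + \<nu> \<beta> (\<mu> z y \<alpha>) x)"

definition bicrossed ::
  "('k::field_char_0, 'g::ab_group_add) ly_structure \<Rightarrow> ('k, 'h::ab_group_add) ly_structure \<Rightarrow>
   ('g \<Rightarrow> 'h \<Rightarrow> 'h) \<Rightarrow> ('g \<Rightarrow> 'g \<Rightarrow> 'h \<Rightarrow> 'h) \<Rightarrow>
   ('h \<Rightarrow> 'g \<Rightarrow> 'g) \<Rightarrow> ('h \<Rightarrow> 'h \<Rightarrow> 'g \<Rightarrow> 'g) \<Rightarrow> ('k, 'g \<times> 'h) ly_structure" where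
  "bicrossed A B \<rho> \<mu> \<psi> \<nu> =
     \<lparr>carrier = carrier A \<times> carrier B,
      scl = (\<lambda>c (x, \<alpha>). (scl A c x, scl B c \<alpha>)),
      br = (\<lambda>(x, \<alpha>) (y, \<beta>).
        (br A x y + \<psi> \<alpha> y - \<psi> \<beta> x, br B \<alpha> \<beta> + \<rho> x \<beta> - \<rho> y \<alpha>)),
      tr = (\<lambda>(x, \<alpha>) (y, \<beta>) (z, \<gamma>).
        (tr A x y z + D_op B \<psi> \<nu> \<alpha> \<beta> z + \<nu> \<beta> \<gamma> x - \<nu> \<alpha> \<gamma> y,
         tr B \<alpha> \<beta> \<gamma> + D_op A \<rho> \<mu> x y \<gamma> + \<mu> y z \<alpha> - \<mu> x z \<beta>))\<rparr>"

text \<open>The canonical matched pair of a strong complement \<open>H\<close> of \<open>G\<close> in \<open>E\<close>: the matched pair whose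
  maps are read off from \<open>E\<close> (the pair \<open>(x, \<alpha>)\<close> being the element \<open>x + \<alpha>\<close> of \<open>E\<close>). The three
  equations determine the maps on the carriers. Being a matched pair is a genuine requirement: the
  axioms of a strong complement alone do not force \<open>\<langle>x, y, \<alpha>\<rangle> \<in> H\<close> and \<open>\<langle>\<alpha>, \<beta>, x\<rangle> \<in> G\<close>, which
  hold in the bicrossed product and amount to the compatibility conditions for \<open>\<psi>\<^sub>\<alpha>[x, y]\<close> and
  \<open>\<rho>\<^sub>x[\<alpha>, \<beta>]\<close>. The identification of \<open>E\<close> with the bicrossed product is a consequence
  (\<open>canonical_br\<close> and \<open>canonical_tr\<close>).\<close>

definition canonical_matched_pair ::
  "('k::field_char_0, 'v::ab_group_add) ly_structure \<Rightarrow> 'v set \<Rightarrow> 'v set \<Rightarrow>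
   ('v \<Rightarrow> 'v \<Rightarrow> 'v) \<Rightarrow> ('v \<Rightarrow> 'v \<Rightarrow> 'v \<Rightarrow> 'v) \<Rightarrow>
   ('v \<Rightarrow> 'v \<Rightarrow> 'v) \<Rightarrow> ('v \<Rightarrow> 'v \<Rightarrow> 'v \<Rightarrow> 'v) \<Rightarrow> bool" where
  "canonical_matched_pair E G H \<rho> \<mu> \<psi> \<nu> \<longleftrightarrow>
     matched_pair (restr E G) (restr E H) \<rho> \<mu> \<psi> \<nu> \<and>
     (\<forall>x\<in>G. \<forall>\<alpha>\<in>H. br E x \<alpha> = - \<psi> \<alpha> x + \<rho> x \<alpha>) \<and>
     (\<forall>\<alpha>\<in>H. \<forall>x\<in>G. \<forall>y\<in>G. tr E \<alpha> x y = \<mu> x y \<alpha>) \<and>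
     (\<forall>x\<in>G. \<forall>\<alpha>\<in>H. \<forall>\<beta>\<in>H. tr E x \<alpha> \<beta> = \<nu> \<alpha> \<beta> x)"

definition pair_sum :: "'v::ab_group_add \<times> 'v \<Rightarrow> 'v" where
  "pair_sum = (\<lambda>(x, \<alpha>). x + \<alpha>)"

context
  fixes E :: "('k::field_char_0, 'v::ab_group_add) ly_structure"
    and G H :: "'v set" and \<rho> \<mu> \<psi> \<nu>
  assumes E: "lie_yamaguti E" and G: "ly_subalgebra G E" and H: "ly_complement E G H"
    and can: "canonical_matched_pair E G H \<rho> \<mu> \<psi> \<nu>"
begin

private lemma GE: "x \<in> G \<Longrightarrow> x \<in> carrier E"
  using G by (auto simp: ly_subalgebra_def)

private lemma HE: "x \<in> H \<Longrightarrow> x \<in> carrier E"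
  using H by (auto simp: ly_subalgebra_def ly_complement_def)

private lemma add_E: "x \<in> carrier E \<Longrightarrow> y \<in> carrier E \<Longrightarrow> x + y \<in> carrier E"
  using E module.subspace_add[of "scl E" "carrier E" x y]
  unfolding lie_yamaguti_def vector_space_on_def
  by (metis module_iff_vector_space)

private lemma br_E: "x \<in> carrier E \<Longrightarrow> y \<in> carrier E \<Longrightarrow> br E x y \<in> carrier E"
  using E by (auto simp: lie_yamaguti_def linear_map_on_def)

private lemma br_addr: "\<lbrakk>x \<in> carrier E; y \<in> carrier E; z \<in> carrier E\<rbrakk> \<Longrightarrow>
    br E x (y + z) = br E x y + br E x z"
  using E by (auto simp: lie_yamaguti_def linear_map_on_def)

private lemma br_addl: "\<lbrakk>x \<in> carrier E; y \<in> carrier E; z \<in> carrier E\<rbrakk> \<Longrightarrow>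
    br E (y + z) x = br E y x + br E z x"
  using E by (auto simp: lie_yamaguti_def linear_map_on_def)

private lemma br_skew: "\<lbrakk>x \<in> carrier E; y \<in> carrier E\<rbrakk> \<Longrightarrow> br E y x = - br E x y"
proof -
  assume xy: "x \<in> carrier E" "y \<in> carrier E"
  have "br E u u = 0" if "u \<in> carrier E" for u
    using E that by (auto simp: lie_yamaguti_def)
  from this[OF xy(1)] this[OF xy(2)] this[OF add_E[OF xy]] show ?thesis
    using xy by (simp add: br_addl br_addr add_E) (metis add.commute eq_neg_iff_add_eq_0)
qed

private lemma tr_add:
  assumes "x \<in> carrier E" "y \<in> carrier E" "z \<in> carrier E" "w \<in> carrier E"
  shows "tr E (x + w) y z = tr E x y z + tr E w y z"
    and "tr E x (y + w) z = tr E x y z + tr E x w z"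
    and "tr E x y (z + w) = tr E x y z + tr E x y w"
  using E assms by (auto simp: lie_yamaguti_def linear_map_on_def)

private lemma tr_skew: "\<lbrakk>x \<in> carrier E; y \<in> carrier E; z \<in> carrier E\<rbrakk> \<Longrightarrow>
    tr E y x z = - tr E x y z"
proof -
  assume xy: "x \<in> carrier E" "y \<in> carrier E" and z: "z \<in> carrier E"
  have "tr E u u z = 0" if "u \<in> carrier E" for u
    using E that z by (auto simp: lie_yamaguti_def)
  from this[OF xy(1)] this[OF xy(2)] this[OF add_E[OF xy]] show ?thesis
    using xy z by (simp add: tr_add add_E) (metis add.commute eq_neg_iff_add_eq_0)
qed

private lemma jac: "\<lbrakk>x \<in> carrier E; y \<in> carrier E; z \<in> carrier E\<rbrakk> \<Longrightarrow>
  br E (br E x y) z + br E (br E y z) x + br E (br E z x) y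
        + tr E x y z + tr E y z x + tr E z x y = 0"
  using E unfolding lie_yamaguti_def by blast

private lemma mp: "matched_pair (restr E G) (restr E H) \<rho> \<mu> \<psi> \<nu>"
  using can by (simp add: canonical_matched_pair_def)

private lemma acts:
  "x \<in> G \<Longrightarrow> \<alpha> \<in> H \<Longrightarrow> \<rho> x \<alpha> \<in> H" "x \<in> G \<Longrightarrow> \<alpha> \<in> H \<Longrightarrow> \<psi> \<alpha> x \<in> G"
  using mp by (auto simp: matched_pair_def ly_representation_def restr_def linear_to_End_def
      linear_map_on_def)

private lemma closed: "x \<in> G \<Longrightarrow> y \<in> G \<Longrightarrow> br E x y \<in> G" "x \<in> H \<Longrightarrow> y \<in> H \<Longrightarrow> br E x y \<in> H"
  using G H by (auto simp: ly_subalgebra_def ly_complement_def)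

private lemma br_GH: "x \<in> G \<Longrightarrow> \<alpha> \<in> H \<Longrightarrow> br E x \<alpha> = - \<psi> \<alpha> x + \<rho> x \<alpha>"
  using can by (simp add: canonical_matched_pair_def)

private lemma br_HG: "x \<in> G \<Longrightarrow> \<alpha> \<in> H \<Longrightarrow> br E \<alpha> x = \<psi> \<alpha> x + - \<rho> x \<alpha>"
  using br_GH[of x \<alpha>] br_skew[of x \<alpha>] GE HE by simp

private lemma tr_HGG: "\<lbrakk>\<alpha> \<in> H; x \<in> G; y \<in> G\<rbrakk> \<Longrightarrow> tr E \<alpha> x y = \<mu> x y \<alpha>"
  using can by (simp add: canonical_matched_pair_def)

private lemma tr_GHH: "\<lbrakk>x \<in> G; \<alpha> \<in> H; \<beta> \<in> H\<rbrakk> \<Longrightarrow> tr E x \<alpha> \<beta> = \<nu> \<alpha> \<beta> x"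
  using can by (simp add: canonical_matched_pair_def)

private lemma tr_GHG: "\<lbrakk>\<alpha> \<in> H; x \<in> G; y \<in> G\<rbrakk> \<Longrightarrow> tr E x \<alpha> y = - \<mu> x y \<alpha>"
  using tr_HGG[of \<alpha> x y] tr_skew[of \<alpha> x y] GE HE by simp

private lemma tr_HGH: "\<lbrakk>x \<in> G; \<alpha> \<in> H; \<beta> \<in> H\<rbrakk> \<Longrightarrow> tr E \<alpha> x \<beta> = - \<nu> \<alpha> \<beta> x"
  using tr_GHH[of x \<alpha> \<beta>] tr_skew[of x \<alpha> \<beta>] GE HE by simp

private lemma neg_E: "x \<in> carrier E \<Longrightarrow> - x \<in> carrier E"
  using E module.subspace_neg[of "scl E" "carrier E" x]
  unfolding lie_yamaguti_def vector_space_on_def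
  by (metis module_iff_vector_space)

private lemma br_minus: "x \<in> carrier E \<Longrightarrow> y \<in> carrier E \<Longrightarrow> br E (- x) y = - br E x y"
  using br_addl[of y x "- x"] br_addl[of y "x + - x" "x + - x"]
  by (simp add: add_E neg_E add_eq_0_iff) (metis add_E neg_E add.right_inverse add_eq_0_iff)

private lemma tr_GGH:
  assumes x: "x \<in> G" and y: "y \<in> G" and a: "\<alpha> \<in> H"
  shows "tr E x y \<alpha> = D_op (restr E G) \<rho> \<mu> x y \<alpha>"
proof -
  have compat: "\<psi> \<alpha> (br E x y) =
      br E (\<psi> \<alpha> x) y + br E x (\<psi> \<alpha> y) + \<psi> (\<rho> y \<alpha>) x - \<psi> (\<rho> x \<alpha>) y"
    using mp x y a unfolding matched_pair_def restr_def by simp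
  have 1: "br E (br E x y) \<alpha> = - \<psi> \<alpha> (br E x y) + \<rho> (br E x y) \<alpha>"
    using x y a by (intro br_GH closed)
  have 2: "br E (br E y \<alpha>) x = br E x (\<psi> \<alpha> y) + (\<psi> (\<rho> y \<alpha>) x + - \<rho> x (\<rho> y \<alpha>))"
    using x y a
    by (simp only: br_GH br_HG br_addl br_minus br_skew[of x "\<psi> \<alpha> y"] minus_minus
        neg_E GE HE acts)
  have 3: "br E (br E \<alpha> x) y = br E (\<psi> \<alpha> x) y + - (\<psi> (\<rho> x \<alpha>) y + - \<rho> y (\<rho> x \<alpha>))"
    using x y a by (simp only: br_HG br_addl br_minus neg_E GE HE acts)
  have "br E (br E x y) \<alpha> + br E (br E y \<alpha>) x + br E (br E \<alpha> x) y
        + tr E x y \<alpha> + tr E y \<alpha> x + tr E \<alpha> x y = 0"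
    using jac x y a GE HE by blast
  then show ?thesis
    using x y a compat unfolding 1 2 3 tr_HGG[OF a x y] tr_GHG[OF a y x]
    by (simp add: D_op_def restr_def algebra_simps eq_neg_iff_add_eq_0 add_eq_0_iff)
qed

private lemma tr_HHG:
  assumes x: "x \<in> G" and a: "\<alpha> \<in> H" and b: "\<beta> \<in> H"
  shows "tr E \<alpha> \<beta> x = D_op (restr E H) \<psi> \<nu> \<alpha> \<beta> x"
proof -
  have compat: "\<rho> x (br E \<alpha> \<beta>) =
      br E (\<rho> x \<alpha>) \<beta> + br E \<alpha> (\<rho> x \<beta>) + \<rho> (\<psi> \<beta> x) \<alpha> - \<rho> (\<psi> \<alpha> x) \<beta>"
    using mp x a b unfolding matched_pair_def restr_def by simp
  have 1: "br E (br E \<alpha> \<beta>) x = \<psi> (br E \<alpha> \<beta>) x + - \<rho> x (br E \<alpha> \<beta>)"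
    using x a b by (intro br_HG closed)
  have 2: "br E (br E \<beta> x) \<alpha> = (- \<psi> \<alpha> (\<psi> \<beta> x) + \<rho> (\<psi> \<beta> x) \<alpha>) + br E \<alpha> (\<rho> x \<beta>)"
    using x a b
    by (simp only: br_GH br_HG br_addl br_minus br_skew[of \<alpha> "\<rho> x \<beta>"] minus_minus
        neg_E GE HE acts)
  have 3: "br E (br E x \<alpha>) \<beta> = - (- \<psi> \<beta> (\<psi> \<alpha> x) + \<rho> (\<psi> \<alpha> x) \<beta>) + br E (\<rho> x \<alpha>) \<beta>"
    using x a b by (simp only: br_GH br_addl br_minus neg_E GE HE acts)
  have "br E (br E \<alpha> \<beta>) x + br E (br E \<beta> x) \<alpha> + br E (br E x \<alpha>) \<beta>
        + tr E \<alpha> \<beta> x + tr E \<beta> x \<alpha> + tr E x \<alpha> \<beta> = 0"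
    using jac x a b GE HE by blast
  then show ?thesis
    using x a b compat unfolding 1 2 3 tr_GHH[OF x a b] tr_HGH[OF x b a]
    by (simp add: D_op_def restr_def algebra_simps eq_neg_iff_add_eq_0 add_eq_0_iff)
qed

lemma canonical_br:
  assumes "x \<in> G" "\<alpha> \<in> H" "y \<in> G" "\<beta> \<in> H"
  shows "br E (x + \<alpha>) (y + \<beta>) =
    pair_sum (br (bicrossed (restr E G) (restr E H) \<rho> \<mu> \<psi> \<nu>) (x, \<alpha>) (y, \<beta>))"
  using assms
  by (simp add: GE HE add_E br_addl br_addr br_GH br_HG bicrossed_def restr_def pair_sum_def
      algebra_simps)

lemma canonical_tr:
  assumes "x \<in> G" "\<alpha> \<in> H" "y \<in> G" "\<beta> \<in> H" "z \<in> G" "\<gamma> \<in> H"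
  shows "tr E (x + \<alpha>) (y + \<beta>) (z + \<gamma>) =
    pair_sum (tr (bicrossed (restr E G) (restr E H) \<rho> \<mu> \<psi> \<nu>) (x, \<alpha>) (y, \<beta>) (z, \<gamma>))"
  using assms
  by (simp add: GE HE add_E tr_add tr_GGH tr_HHG tr_HGG tr_GHH tr_GHG tr_HGH bicrossed_def
      pair_sum_def algebra_simps) (simp add: restr_def)

end

section \<open>Deformation maps\<close>

definition deformation_map ::
  "('k::field_char_0, 'g::ab_group_add) ly_structure \<Rightarrow> ('k, 'h::ab_group_add) ly_structure \<Rightarrow>
   ('g \<Rightarrow> 'h \<Rightarrow> 'h) \<Rightarrow> ('g \<Rightarrow> 'g \<Rightarrow> 'h \<Rightarrow> 'h) \<Rightarrow>
   ('h \<Rightarrow> 'g \<Rightarrow> 'g) \<Rightarrow> ('h \<Rightarrow> 'h \<Rightarrow> 'g \<Rightarrow> 'g) \<Rightarrow> ('h \<Rightarrow> 'g) \<Rightarrow> bool" where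
  "deformation_map A B \<rho> \<mu> \<psi> \<nu> r \<longleftrightarrow>
     linear_map_on (scl B) (carrier B) (scl A) (carrier A) r \<and>
     (\<forall>\<alpha>\<in>carrier B. \<forall>\<beta>\<in>carrier B.
        br A (r \<alpha>) (r \<beta>) + \<psi> \<alpha> (r \<beta>) - \<psi> \<beta> (r \<alpha>) =
        r (br B \<alpha> \<beta> + \<rho> (r \<alpha>) \<beta> - \<rho> (r \<beta>) \<alpha>)) \<and>
     (\<forall>\<alpha>\<in>carrier B. \<forall>\<beta>\<in>carrier B. \<forall>\<gamma>\<in>carrier B.
        tr A (r \<alpha>) (r \<beta>) (r \<gamma>) + D_op B \<psi> \<nu> \<alpha> \<beta> (r \<gamma>) + \<nu> \<beta> \<gamma> (r \<alpha>) - \<nu> \<alpha> \<gamma> (r \<beta>) =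
        r (tr B \<alpha> \<beta> \<gamma> + D_op A \<rho> \<mu> (r \<alpha>) (r \<beta>) \<gamma> + \<mu> (r \<beta>) (r \<gamma>) \<alpha> - \<mu> (r \<alpha>) (r \<gamma>) \<beta>))"

text \<open>The graph, as a subset of \<open>E\<close> via \<open>pair_sum\<close>.\<close>

definition graph_in :: "'v::ab_group_add set \<Rightarrow> ('v \<Rightarrow> 'v) \<Rightarrow> 'v set" where
  "graph_in H r = pair_sum ` {(r \<alpha>, \<alpha>) | \<alpha>. \<alpha> \<in> H}"

end

(* For alpha, beta in H, the bracket of r alpha + alpha and r beta + beta in E splits as P + Q with
   P in G and Q in H, and the first deformation equation says exactly P = r Q, i.e. that the
   bracket lies in the graph of r; likewise for the ternary operation. Conversely, a complement
   Hbar contains for each alpha in H a unique element of the form x + alpha with x in G, and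
   r alpha := x has graph Hbar. *)
theory Submission
  imports Defs
begin

lemma vector_space_on_closed:
  assumes "vector_space_on s V"
  shows "0 \<in> V"
    and "x \<in> V \<Longrightarrow> y \<in> V \<Longrightarrow> x + y \<in> V"
    and "x \<in> V \<Longrightarrow> y \<in> V \<Longrightarrow> x - y \<in> V"
    and "x \<in> V \<Longrightarrow> - x \<in> V"
    and "x \<in> V \<Longrightarrow> s c x \<in> V"
proof -
  have m: "module s" and V: "module.subspace s V"
    using assms by (simp_all add: vector_space_on_def module_iff_vector_space)
  show "0 \<in> V" using m V by (rule module.subspace_0)
  show "x \<in> V \<Longrightarrow> y \<in> V \<Longrightarrow> x + y \<in> V" using m V by (rule module.subspace_add)
  show "x \<in> V \<Longrightarrow> y \<in> V \<Longrightarrow> x - y \<in> V" using m V by (rule module.subspace_diff)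
  show "x \<in> V \<Longrightarrow> - x \<in> V" using m V by (rule module.subspace_neg)
  show "x \<in> V \<Longrightarrow> s c x \<in> V" using m V by (rule module.subspace_scale)
qed

lemma vector_space_on_scale_add:
  assumes "vector_space_on s V"
  shows "s c (x + y) = s c x + s c y"
  using assms by (simp add: vector_space_on_def vector_space.vector_space_assms(1))

lemma vector_space_on_subalgebra:
  assumes "lie_yamaguti L" "ly_subalgebra S L"
  shows "vector_space_on (scl L) S"
  using assms by (simp add: lie_yamaguti_def ly_subalgebra_def vector_space_on_def)

lemma D_op_closed:
  assumes "lie_yamaguti L" "ly_representation L s V \<rho> \<mu>"
    and "x \<in> carrier L" "y \<in> carrier L" "v \<in> V"
  shows "D_op L \<rho> \<mu> x y v \<in> V"
proof -
  have "vector_space_on s V" using assms by (simp add: ly_representation_def)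
  moreover have "\<rho> a u \<in> V" if "a \<in> carrier L" "u \<in> V" for a u
    using assms(2) that by (simp add: ly_representation_def linear_to_End_def linear_map_on_def)
  moreover have "\<mu> a b u \<in> V" if "a \<in> carrier L" "b \<in> carrier L" "u \<in> V" for a b u
    using assms(2) that
    by (simp add: ly_representation_def bilinear_to_End_def linear_to_End_def linear_map_on_def)
  moreover have "br L x y \<in> carrier L"
    using assms by (simp add: lie_yamaguti_def linear_map_on_def)
  ultimately show ?thesis
    using assms(3-5) unfolding D_op_def by (simp add: vector_space_on_closed)
qed

lemma bicrossed_closed:
  assumes "matched_pair A B \<rho> \<mu> \<psi> \<nu>"
    and "p \<in> carrier A \<times> carrier B" "q \<in> carrier A \<times> carrier B"
  shows "br (bicrossed A B \<rho> \<mu> \<psi> \<nu>) p q \<in> carrier A \<times> carrier B"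
    and "t \<in> carrier A \<times> carrier B \<Longrightarrow>
      tr (bicrossed A B \<rho> \<mu> \<psi> \<nu>) p q t \<in> carrier A \<times> carrier B"
proof -
  have A: "lie_yamaguti A" and B: "lie_yamaguti B"
    and R: "ly_representation A (scl B) (carrier B) \<rho> \<mu>"
    and S: "ly_representation B (scl A) (carrier A) \<psi> \<nu>"
    using assms(1) by (simp_all add: matched_pair_def)
  have "vector_space_on (scl A) (carrier A)" "vector_space_on (scl B) (carrier B)"
    using A B by (simp_all add: lie_yamaguti_def)
  note vs = this[THEN vector_space_on_closed(2)] this[THEN vector_space_on_closed(3)]
  have "\<forall>x\<in>carrier A. \<forall>y\<in>carrier A. br A x y \<in> carrier A"
      "\<forall>x\<in>carrier A. \<forall>y\<in>carrier A. \<forall>z\<in>carrier A. tr A x y z \<in> carrier A"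
    using A by (simp_all add: lie_yamaguti_def linear_map_on_def)
  moreover have "\<forall>x\<in>carrier B. \<forall>y\<in>carrier B. br B x y \<in> carrier B"
      "\<forall>x\<in>carrier B. \<forall>y\<in>carrier B. \<forall>z\<in>carrier B. tr B x y z \<in> carrier B"
    using B by (simp_all add: lie_yamaguti_def linear_map_on_def)
  moreover have "\<forall>x\<in>carrier A. \<forall>\<alpha>\<in>carrier B. \<rho> x \<alpha> \<in> carrier B"
      "\<forall>x\<in>carrier A. \<forall>y\<in>carrier A. \<forall>\<alpha>\<in>carrier B. \<mu> x y \<alpha> \<in> carrier B"
    using R by (simp_all add: ly_representation_def bilinear_to_End_def linear_to_End_def
        linear_map_on_def)
  moreover have "\<forall>\<alpha>\<in>carrier B. \<forall>x\<in>carrier A. \<psi> \<alpha> x \<in> carrier A"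
      "\<forall>\<alpha>\<in>carrier B. \<forall>\<beta>\<in>carrier B. \<forall>x\<in>carrier A. \<nu> \<alpha> \<beta> x \<in> carrier A"
    using S by (simp_all add: ly_representation_def bilinear_to_End_def linear_to_End_def
        linear_map_on_def)
  ultimately show "br (bicrossed A B \<rho> \<mu> \<psi> \<nu>) p q \<in> carrier A \<times> carrier B"
    "t \<in> carrier A \<times> carrier B \<Longrightarrow>
      tr (bicrossed A B \<rho> \<mu> \<psi> \<nu>) p q t \<in> carrier A \<times> carrier B"
    using assms(2,3)
    by (auto simp: bicrossed_def vs D_op_closed[OF A R] D_op_closed[OF B S])
qed

lemma complement_unique:
  assumes "lie_yamaguti E" "ly_subalgebra G E" "ly_complement E G H"
    and "x \<in> G" "y \<in> G" "x + \<alpha> \<in> H" "y + \<alpha> \<in> H"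
  shows "x = y"
proof -
  have "x - y \<in> G" using assms by (meson vector_space_on_subalgebra vector_space_on_closed(3))
  moreover have "(x + \<alpha>) - (y + \<alpha>) \<in> H"
    using assms by (meson ly_complement_def vector_space_on_subalgebra vector_space_on_closed(3))
  ultimately have "x - y \<in> G \<inter> H" by simp
  then have "x - y \<in> {0}" using assms(3) by (simp only: ly_complement_def)
  then show ?thesis by simp
qed

lemma mem_graph_in: "u \<in> graph_in H r \<longleftrightarrow> (\<exists>\<alpha>\<in>H. u = r \<alpha> + \<alpha>)"
  by (auto simp: graph_in_def pair_sum_def)

lemma graph_in_unique:
  assumes "lie_yamaguti E" "ly_subalgebra G E" "ly_complement E G H"
    and "\<And>\<alpha>. \<alpha> \<in> H \<Longrightarrow> r \<alpha> \<in> G" "p \<in> G \<times> H"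
  shows "pair_sum p \<in> graph_in H r \<longleftrightarrow> fst p = r (snd p)"
proof
  obtain x \<alpha> where p: "p = (x, \<alpha>)" "x \<in> G" "\<alpha> \<in> H" using assms(5) by auto
  assume "pair_sum p \<in> graph_in H r"
  then obtain \<beta> where \<beta>: "\<beta> \<in> H" "x + \<alpha> = r \<beta> + \<beta>"
    by (auto simp: p pair_sum_def mem_graph_in)
  have vs: "vector_space_on (scl E) G" "vector_space_on (scl E) H"
    using assms by (auto simp: ly_complement_def intro: vector_space_on_subalgebra)
  have eq: "x - r \<beta> = \<beta> - \<alpha>" using \<beta>(2) by (simp add: algebra_simps)
  have "x - r \<beta> \<in> G" "\<beta> - \<alpha> \<in> H"
    using p \<beta>(1) assms(4) vs by (auto intro: vector_space_on_closed(3))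
  then have "x - r \<beta> \<in> G \<inter> H" by (simp add: eq)
  then have "x - r \<beta> \<in> {0}" using assms(3) by (simp only: ly_complement_def)
  then show "fst p = r (snd p)" using eq by (simp add: p)
next
  assume "fst p = r (snd p)"
  then show "pair_sum p \<in> graph_in H r"
    using assms(5) by (auto simp: mem_graph_in pair_sum_def)
qed

lemma deformation_map_iff_graph_closed:
  assumes E: "lie_yamaguti E" and G: "ly_subalgebra G E" and H: "ly_complement E G H"
    and can: "canonical_matched_pair E G H \<rho> \<mu> \<psi> \<nu>"
    and r: "linear_map_on (scl E) H (scl E) G r"
  shows "deformation_map (restr E G) (restr E H) \<rho> \<mu> \<psi> \<nu> r \<longleftrightarrow>
    (\<forall>u\<in>graph_in H r. \<forall>v\<in>graph_in H r. br E u v \<in> graph_in H r) \<and>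
    (\<forall>u\<in>graph_in H r. \<forall>v\<in>graph_in H r. \<forall>w\<in>graph_in H r. tr E u v w \<in> graph_in H r)"
proof -
  let ?A = "restr E G" and ?B = "restr E H"
  let ?M = "bicrossed ?A ?B \<rho> \<mu> \<psi> \<nu>"
  have rG: "r \<alpha> \<in> G" if "\<alpha> \<in> H" for \<alpha>
    using r that by (simp add: linear_map_on_def)
  have mp: "matched_pair ?A ?B \<rho> \<mu> \<psi> \<nu>"
    using can by (simp add: canonical_matched_pair_def)
  have carr: "carrier ?A = G" "carrier ?B = H" "scl ?A = scl E" "scl ?B = scl E"
    by (simp_all add: restr_def)
  have br: "br E (r \<alpha> + \<alpha>) (r \<beta> + \<beta>) \<in> graph_in H r \<longleftrightarrow>
      br ?A (r \<alpha>) (r \<beta>) + \<psi> \<alpha> (r \<beta>) - \<psi> \<beta> (r \<alpha>) =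
        r (br ?B \<alpha> \<beta> + \<rho> (r \<alpha>) \<beta> - \<rho> (r \<beta>) \<alpha>)"
    if "\<alpha> \<in> H" "\<beta> \<in> H" for \<alpha> \<beta>
  proof -
    have "br ?M (r \<alpha>, \<alpha>) (r \<beta>, \<beta>) \<in> G \<times> H"
      using bicrossed_closed(1)[OF mp] that rG by (simp add: carr)
    then have "br E (r \<alpha> + \<alpha>) (r \<beta> + \<beta>) \<in> graph_in H r \<longleftrightarrow>
        fst (br ?M (r \<alpha>, \<alpha>) (r \<beta>, \<beta>)) = r (snd (br ?M (r \<alpha>, \<alpha>) (r \<beta>, \<beta>)))"
      using that rG by (simp only: canonical_br[OF E G H can] graph_in_unique[OF E G H])
    then show ?thesis by (simp add: bicrossed_def)
  qed
  have tr: "tr E (r \<alpha> + \<alpha>) (r \<beta> + \<beta>) (r \<gamma> + \<gamma>) \<in> graph_in H r \<longleftrightarrow>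
      tr ?A (r \<alpha>) (r \<beta>) (r \<gamma>) + D_op ?B \<psi> \<nu> \<alpha> \<beta> (r \<gamma>) + \<nu> \<beta> \<gamma> (r \<alpha>) - \<nu> \<alpha> \<gamma> (r \<beta>) =
        r (tr ?B \<alpha> \<beta> \<gamma> + D_op ?A \<rho> \<mu> (r \<alpha>) (r \<beta>) \<gamma> + \<mu> (r \<beta>) (r \<gamma>) \<alpha> - \<mu> (r \<alpha>) (r \<gamma>) \<beta>)"
    if "\<alpha> \<in> H" "\<beta> \<in> H" "\<gamma> \<in> H" for \<alpha> \<beta> \<gamma>
  proof -
    have "tr ?M (r \<alpha>, \<alpha>) (r \<beta>, \<beta>) (r \<gamma>, \<gamma>) \<in> G \<times> H"
      using bicrossed_closed(2)[OF mp] that rG by (simp add: carr)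
    then have "tr E (r \<alpha> + \<alpha>) (r \<beta> + \<beta>) (r \<gamma> + \<gamma>) \<in> graph_in H r \<longleftrightarrow>
        fst (tr ?M (r \<alpha>, \<alpha>) (r \<beta>, \<beta>) (r \<gamma>, \<gamma>)) =
        r (snd (tr ?M (r \<alpha>, \<alpha>) (r \<beta>, \<beta>) (r \<gamma>, \<gamma>)))"
      using that rG by (simp only: canonical_tr[OF E G H can] graph_in_unique[OF E G H])
    then show ?thesis by (simp add: bicrossed_def)
  qed
  have graph: "(\<forall>u\<in>graph_in H r. P u) \<longleftrightarrow> (\<forall>\<alpha>\<in>H. P (r \<alpha> + \<alpha>))" for P
    unfolding Ball_def mem_graph_in by blast
  show ?thesis
    unfolding deformation_map_def carr graph using r by (simp add: br tr)
qed

lemma subspace_graph_in: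
  assumes H: "vector_space_on s H" and r: "linear_map_on s H s G r"
  shows "module.subspace s (graph_in H r)"
proof -
  have s: "vector_space s" using H by (simp add: vector_space_on_def)
  have add: "r (\<alpha> + \<beta>) = r \<alpha> + r \<beta>" if "\<alpha> \<in> H" "\<beta> \<in> H" for \<alpha> \<beta>
    using r that by (simp add: linear_map_on_def)
  have scale: "r (s c \<alpha>) = s c (r \<alpha>)" if "\<alpha> \<in> H" for c \<alpha>
    using r that by (simp add: linear_map_on_def)
  have "r 0 = 0" using add[of 0 0] vector_space_on_closed(1)[OF H] by simp
  then have "0 \<in> graph_in H r"
    using vector_space_on_closed(1)[OF H] by (force simp: mem_graph_in)
  moreover have "u + v \<in> graph_in H r" if uv: "u \<in> graph_in H r" "v \<in> graph_in H r" for u v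
  proof -
    obtain \<alpha> \<beta> where "\<alpha> \<in> H" "u = r \<alpha> + \<alpha>" "\<beta> \<in> H" "v = r \<beta> + \<beta>"
      using uv by (auto simp: mem_graph_in)
    then show ?thesis
      unfolding mem_graph_in
      by (intro bexI[of _ "\<alpha> + \<beta>"]) (simp_all add: add vector_space_on_closed(2)[OF H])
  qed
  moreover have "s c u \<in> graph_in H r" if u: "u \<in> graph_in H r" for c u
  proof -
    obtain \<alpha> where "\<alpha> \<in> H" "u = r \<alpha> + \<alpha>" using u by (auto simp: mem_graph_in)
    then show ?thesis
      unfolding mem_graph_in
      by (intro bexI[of _ "s c \<alpha>"])
        (simp_all add: scale vector_space_on_closed(5)[OF H] vector_space_on_scale_add[OF H])
  qed
  ultimately show ?thesis
    using s by (simp add: module.subspace_def module_iff_vector_space)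
qed

lemma complement_graph_in:
  assumes E: "lie_yamaguti E" and G: "ly_subalgebra G E" and H: "ly_complement E G H"
    and can: "canonical_matched_pair E G H \<rho> \<mu> \<psi> \<nu>"
    and def: "deformation_map (restr E G) (restr E H) \<rho> \<mu> \<psi> \<nu> r"
  shows "ly_complement E G (graph_in H r)"
proof -
  have r: "linear_map_on (scl E) H (scl E) G r"
    using def by (simp add: deformation_map_def restr_def)
  then have rG: "r \<alpha> \<in> G" if "\<alpha> \<in> H" for \<alpha>
    using that by (simp add: linear_map_on_def)
  have vG: "vector_space_on (scl E) G" and vH: "vector_space_on (scl E) H"
    using E G H by (auto simp: ly_complement_def intro: vector_space_on_subalgebra)
  have carr: "carrier E = {x + \<alpha> | x \<alpha>. x \<in> G \<and> \<alpha> \<in> H}"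
    using H by (simp add: ly_complement_def)
  have sub: "graph_in H r \<subseteq> carrier E"
    unfolding carr using rG by (fastforce simp: mem_graph_in)
  have space: "module.subspace (scl E) (graph_in H r)"
    using vH r by (rule subspace_graph_in)
  have "ly_subalgebra (graph_in H r) E"
    using sub space def deformation_map_iff_graph_closed[OF E G H can r]
    by (simp add: ly_subalgebra_def)
  moreover have "carrier E = {x + u | x u. x \<in> G \<and> u \<in> graph_in H r}"
  proof (intro equalityI subsetI)
    fix e assume "e \<in> carrier E"
    then obtain x \<alpha> where e: "e = x + \<alpha>" "x \<in> G" "\<alpha> \<in> H" by (auto simp: carr)
    have "e = (x - r \<alpha>) + (r \<alpha> + \<alpha>)" by (simp add: e)
    moreover have "x - r \<alpha> \<in> G" using e rG vG by (simp add: vector_space_on_closed)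
    moreover have "r \<alpha> + \<alpha> \<in> graph_in H r" using e by (auto simp: mem_graph_in)
    ultimately show "e \<in> {x + u | x u. x \<in> G \<and> u \<in> graph_in H r}" by blast
  next
    fix e assume "e \<in> {x + u | x u. x \<in> G \<and> u \<in> graph_in H r}"
    then obtain x \<alpha> where e: "e = (x + r \<alpha>) + \<alpha>" "x \<in> G" "\<alpha> \<in> H"
      by (auto simp: mem_graph_in add.assoc)
    have "x + r \<alpha> \<in> G" using e rG vG by (simp add: vector_space_on_closed)
    then show "e \<in> carrier E" using e unfolding carr by blast
  qed
  moreover have "G \<inter> graph_in H r = {0}"
  proof (intro equalityI subsetI)
    fix u assume u: "u \<in> G \<inter> graph_in H r"
    have p: "(u, 0) \<in> G \<times> H" using u vH by (simp add: vector_space_on_closed)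
    have "pair_sum (u, 0) \<in> graph_in H r" using u by (simp add: pair_sum_def)
    then have "u = r 0" using graph_in_unique[OF E G H rG p] by simp
    moreover have "r (0 + 0) = r 0 + r 0"
      using r vector_space_on_closed(1)[OF vH] unfolding linear_map_on_def by blast
    ultimately show "u \<in> {0}" by simp
  next
    fix u :: 'b assume "u \<in> {0}"
    moreover have "vector_space_on (scl E) (graph_in H r)"
      using space vH by (simp add: vector_space_on_def)
    ultimately show "u \<in> G \<inter> graph_in H r"
      using vector_space_on_closed(1) vG by auto
  qed
  ultimately show ?thesis by (simp add: ly_complement_def)
qed

lemma complement_as_graph_in:
  assumes E: "lie_yamaguti E" and G: "ly_subalgebra G E"
    and H: "ly_complement E G H" and K: "ly_complement E G K"
  obtains r where "linear_map_on (scl E) H (scl E) G r" "K = graph_in H r"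
proof -
  have vG: "vector_space_on (scl E) G" and vH: "vector_space_on (scl E) H"
    and vK: "vector_space_on (scl E) K"
    using E G H K by (auto simp: ly_complement_def intro: vector_space_on_subalgebra)
  note [simp] = vector_space_on_closed[OF vG] vector_space_on_closed[OF vH]
  have "\<exists>x\<in>G. x + \<alpha> \<in> K" if "\<alpha> \<in> H" for \<alpha>
  proof -
    have "\<alpha> \<in> carrier E" using H that by (auto simp: ly_complement_def ly_subalgebra_def)
    then obtain x k where "\<alpha> = x + k" "x \<in> G" "k \<in> K" using K by (auto simp: ly_complement_def)
    then show ?thesis by (intro bexI[of _ "- x"]) simp_all
  qed
  then obtain r where rG: "\<And>\<alpha>. \<alpha> \<in> H \<Longrightarrow> r \<alpha> \<in> G" and rK: "\<And>\<alpha>. \<alpha> \<in> H \<Longrightarrow> r \<alpha> + \<alpha> \<in> K"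
    by metis
  note unique = complement_unique[OF E G K]
  have "r (\<alpha> + \<beta>) = r \<alpha> + r \<beta>" if "\<alpha> \<in> H" "\<beta> \<in> H" for \<alpha> \<beta>
  proof (rule unique)
    show "r \<alpha> + r \<beta> + (\<alpha> + \<beta>) \<in> K"
      using vector_space_on_closed(2)[OF vK rK[OF that(1)] rK[OF that(2)]]
      by (simp add: algebra_simps)
  qed (use that rG rK in simp_all)
  moreover have "r (scl E c \<alpha>) = scl E c (r \<alpha>)" if "\<alpha> \<in> H" for c \<alpha>
  proof (rule unique)
    show "scl E c (r \<alpha>) + scl E c \<alpha> \<in> K"
      using vector_space_on_closed(5)[OF vK rK[OF that]]
      by (simp add: vector_space_on_scale_add[OF vK])
  qed (use that rG rK in simp_all)
  ultimately have lin: "linear_map_on (scl E) H (scl E) G r"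
    using rG by (simp add: linear_map_on_def)
  have "k \<in> graph_in H r" if "k \<in> K" for k
  proof -
    have "k \<in> carrier E" using K that by (auto simp: ly_complement_def ly_subalgebra_def)
    then obtain x \<alpha> where k: "k = x + \<alpha>" "x \<in> G" "\<alpha> \<in> H" using H by (auto simp: ly_complement_def)
    then have "x = r \<alpha>" using unique that rG rK by blast
    then show ?thesis using k by (auto simp: mem_graph_in)
  qed
  then have "K = graph_in H r" using rK by (auto simp: mem_graph_in)
  with lin show ?thesis by (rule that)
qed

theorem theorem4p9:
  fixes E :: "('k::field_char_0, 'v::ab_group_add) ly_structure"
    and G H :: "'v set"
    and \<rho> \<psi> :: "'v \<Rightarrow> 'v \<Rightarrow> 'v"
    and \<mu> \<nu> :: "'v \<Rightarrow> 'v \<Rightarrow> 'v \<Rightarrow> 'v"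
  assumes "lie_yamaguti E"
    and "ly_subalgebra G E"
    and "strong_ly_complement E G H"
    and "canonical_matched_pair E G H \<rho> \<mu> \<psi> \<nu>"
  shows "(\<forall>r. deformation_map (restr E G) (restr E H) \<rho> \<mu> \<psi> \<nu> r \<longrightarrow>
            ly_complement E G (graph_in H r)) \<and>
         (\<forall>Hbar. ly_complement E G Hbar \<longrightarrow>
            (\<exists>r. deformation_map (restr E G) (restr E H) \<rho> \<mu> \<psi> \<nu> r \<and>
                 restr E Hbar = restr E (graph_in H r)))"
proof (intro conjI allI impI)
  have H: "ly_complement E G H" using assms(3) by (simp add: strong_ly_complement_def)
  show "ly_complement E G (graph_in H r)"
    if "deformation_map (restr E G) (restr E H) \<rho> \<mu> \<psi> \<nu> r" for r
    using assms(1,2) H assms(4) that by (rule complement_graph_in)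
  fix K assume K: "ly_complement E G K"
  obtain r where r: "linear_map_on (scl E) H (scl E) G r" "K = graph_in H r"
    using assms(1,2) H K by (rule complement_as_graph_in)
  have "deformation_map (restr E G) (restr E H) \<rho> \<mu> \<psi> \<nu> r"
    using K deformation_map_iff_graph_closed[OF assms(1,2) H assms(4) r(1)]
    by (simp add: ly_complement_def ly_subalgebra_def flip: r(2))
  then show "\<exists>r. deformation_map (restr E G) (restr E H) \<rho> \<mu> \<psi> \<nu> r \<and>
      restr E K = restr E (graph_in H r)"
    using r(2) by blast
qed

end
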